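(* Let $X$ be a finite dimensional real Banach space with $\dim X\geqslant2$. If $L_X(t_0)=2t_0^2-4t_0+2$ for some $t_0\in[0,\frac12)$, then $X$ is not uniformly non-square.
   Context: For $x,y$ in a real Banach space $X$, isosceles orthogonality $x\perp_I y$ means $\|x+y\|=\|x-y\|$. For $0\leqslant t<\frac12$ define $$L_X(t)=\sup\left\{\frac{\|tx+(1-t)y\|^2+\|(1-t)x+ty\|^2}{\|x+y\|^2}: x,y\in X,\ (x,y)\neq(0,0),\ x\perp_I y\right\}.$$ Let $S_X=\{x\in X:\|x\|=1\}$. $X$ is uniformly non-square if there exists $\delta\in(0,1)$ such that for all $x,y\in S_X$, $\|x+y\|\leqslant2(1-\delta)$ or $\|x-y\|\leqslant2(1-\delta)$. *)

theory Defs
  imports "HOL-Analysis.Analysis"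
begin

text \<open>The Banach space \<open>X\<close> is a type \<open>'a\<close>; notions that depend on \<open>X\<close> alone take \<open>TYPE('a)\<close>
  as an argument.\<close>

definition isosceles_orth :: "'a::real_normed_vector \<Rightarrow> 'a \<Rightarrow> bool"  (infix "\<bottom>\<^sub>I" 50)
  where "x \<bottom>\<^sub>I y \<longleftrightarrow> norm (x + y) = norm (x - y)"

definition L_set :: "'a::real_normed_vector itself \<Rightarrow> real \<Rightarrow> real set"
  where "L_set _ t =
    {((norm (t *\<^sub>R x + (1 - t) *\<^sub>R y))\<^sup>2 + (norm ((1 - t) *\<^sub>R x + t *\<^sub>R y))\<^sup>2) / (norm (x + y))\<^sup>2
      | x y :: 'a. (x, y) \<noteq> (0, 0) \<and> x \<bottom>\<^sub>I y}"

definition L_const :: "'a::real_normed_vector itself \<Rightarrow> real \<Rightarrow> real"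
  where "L_const X t = Sup (L_set X t)"

definition uniformly_non_square :: "'a::real_normed_vector itself \<Rightarrow> bool"
  where "uniformly_non_square _ \<longleftrightarrow>
    (\<exists>\<delta>\<in>{0<..<1::real}. \<forall>x\<in>sphere (0::'a) 1. \<forall>y\<in>sphere (0::'a) 1.
       norm (x + y) \<le> 2 * (1 - \<delta>) \<or> norm (x - y) \<le> 2 * (1 - \<delta>))"

text \<open>The next three facts show that neither division by zero nor the supremum of an empty or
  unbounded set of reals occurs in \<^const>\<open>L_const\<close>.\<close>

lemma isosceles_orth_add_nonzero:
  fixes x y :: "'a::real_normed_vector"
  assumes "x \<bottom>\<^sub>I y" "(x, y) \<noteq> (0, 0)"
  shows "x + y \<noteq> 0"
proof
  assume s: "x + y = 0"
  then have "x = y" using assms(1) by (simp add: isosceles_orth_def)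
  then have "2 *\<^sub>R x = 0" using s by (simp add: scaleR_2)
  then show False using \<open>x = y\<close> assms(2) by simp
qed

lemma L_set_nonempty:
  assumes "\<exists>x::'a::real_normed_vector. x \<noteq> 0"
  shows "L_set TYPE('a) t \<noteq> {}"
proof -
  obtain x :: 'a where "x \<noteq> 0" using assms by blast
  moreover have "x \<bottom>\<^sub>I 0" by (simp add: isosceles_orth_def)
  ultimately show ?thesis unfolding L_set_def by blast
qed

lemma L_set_bdd_above:
  assumes "0 \<le> t" "t < 1/2"
  shows "bdd_above (L_set TYPE('a::real_normed_vector) t)"
proof (rule bdd_aboveI[where M = 2])
  fix r assume "r \<in> L_set TYPE('a) t"
  then obtain x y :: 'a where o: "x \<bottom>\<^sub>I y" "(x, y) \<noteq> (0, 0)" and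
    r: "r = ((norm (t *\<^sub>R x + (1 - t) *\<^sub>R y))\<^sup>2 + (norm ((1 - t) *\<^sub>R x + t *\<^sub>R y))\<^sup>2)
          / (norm (x + y))\<^sup>2"
    unfolding L_set_def by blast
  let ?n = "norm (x + y)"
  have e: "norm (x - y) = ?n" using o(1) by (simp add: isosceles_orth_def)
  have "norm (2 *\<^sub>R x) \<le> 2 * ?n" "norm (2 *\<^sub>R y) \<le> 2 * ?n"
    using norm_triangle_ineq[of "x + y" "x - y"] norm_triangle_ineq4[of "x + y" "x - y"] e
    by (simp_all add: scaleR_2)
  then have x: "norm x \<le> ?n" and y: "norm y \<le> ?n" by simp_all
  have conv: "norm (a *\<^sub>R x + (1 - a) *\<^sub>R y) \<le> ?n" if "0 \<le> a" "a \<le> 1" for a :: real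
  proof -
    have "norm (a *\<^sub>R x + (1 - a) *\<^sub>R y) \<le> a * norm x + (1 - a) * norm y"
      using norm_triangle_ineq[of "a *\<^sub>R x" "(1 - a) *\<^sub>R y"] that by simp
    also have "\<dots> \<le> ?n" using convex_bound_le[OF x y, of a "1 - a"] that by simp
    finally show ?thesis .
  qed
  have "(norm (t *\<^sub>R x + (1 - t) *\<^sub>R y))\<^sup>2 \<le> ?n\<^sup>2" "(norm ((1 - t) *\<^sub>R x + t *\<^sub>R y))\<^sup>2 \<le> ?n\<^sup>2"
    using conv[of t] conv[of "1 - t"] assms by (simp_all add: power_mono)
  moreover have "0 < ?n\<^sup>2" using isosceles_orth_add_nonzero[OF o] by simp
  ultimately show "r \<le> 2" unfolding r pos_divide_le_eq[OF \<open>0 < ?n\<^sup>2\<close>] by linarith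
qed

end

theory Submission
  imports Defs
begin

text \<open>Put \<open>n = \<parallel>x + y\<parallel> = \<parallel>x - y\<parallel>\<close>. Since \<open>2x = (x + y) + (x - y)\<close> and \<open>2y = (x + y) - (x - y)\<close>,
  uniform non-squareness applied to \<open>(x \<plusminus> y) / n\<close> makes one of \<open>\<parallel>x\<parallel>, \<parallel>y\<parallel>\<close> at most \<open>(1 - \<delta>) n\<close>,
  the other one being at most \<open>n\<close> anyway. Writing \<open>(1 - t)x + ty = t(x + y) + (1 - 2t)x\<close>, and
  symmetrically, the quotients defining \<open>L\<^sub>X(t)\<close> stay below a bound strictly smaller than
  \<open>2(1 - t)\<^sup>2 = 2t\<^sup>2 - 4t + 2\<close>.\<close>

lemma norm_combination_le:
  fixes x y :: "'a::real_normed_vector"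
  assumes "0 \<le> t" "t \<le> 1/2" "norm x \<le> c * norm (x + y)"
  shows "norm ((1 - t) *\<^sub>R x + t *\<^sub>R y) \<le> (t + (1 - 2 * t) * c) * norm (x + y)"
proof -
  have "(1 - t) *\<^sub>R x + t *\<^sub>R y = t *\<^sub>R (x + y) + (1 - 2 * t) *\<^sub>R x"
    by (simp add: algebra_simps flip: scaleR_left_distrib)
  then have "norm ((1 - t) *\<^sub>R x + t *\<^sub>R y) \<le> t * norm (x + y) + (1 - 2 * t) * norm x"
    using norm_triangle_ineq[of "t *\<^sub>R (x + y)" "(1 - 2 * t) *\<^sub>R x"] assms(1,2) by simp
  also have "\<dots> \<le> t * norm (x + y) + (1 - 2 * t) * (c * norm (x + y))"
    using mult_left_mono[OF assms(3), of "1 - 2 * t"] assms(2) by simp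
  finally show ?thesis by (simp add: algebra_simps)
qed

lemma isosceles_orth_commute: "x \<bottom>\<^sub>I y \<longleftrightarrow> y \<bottom>\<^sub>I x"
  by (simp add: isosceles_orth_def add.commute norm_minus_commute)

lemma isosceles_orth_norm_le:
  assumes "x \<bottom>\<^sub>I y"
  shows "norm x \<le> norm (x + y)"
proof -
  have "norm (2 *\<^sub>R x) \<le> norm (x + y) + norm (x - y)"
    using norm_triangle_ineq[of "x + y" "x - y"] by (simp add: scaleR_2)
  then show ?thesis using assms by (simp add: isosceles_orth_def)
qed

text \<open>The two combinations are estimated separately: the one leaning towards \<open>y\<close>
  uses only the bound that orthogonality gives, the one leaning towards \<open>x\<close> uses the
  factor \<open>c\<close>.\<close>

lemma quotient_le_of_norm_le:
  fixes x y :: "'a::real_normed_vector"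
  assumes "x \<bottom>\<^sub>I y" "x + y \<noteq> 0" "0 \<le> t" "t \<le> 1/2" "norm x \<le> c * norm (x + y)"
  shows "((norm (t *\<^sub>R x + (1 - t) *\<^sub>R y))\<^sup>2 + (norm ((1 - t) *\<^sub>R x + t *\<^sub>R y))\<^sup>2) / (norm (x + y))\<^sup>2
    \<le> (1 - t)\<^sup>2 + (t + (1 - 2 * t) * c)\<^sup>2"
proof -
  \<comment> \<open>Factor 1 makes the coefficient \<open>t + (1 - 2 * t) * 1\<close> collapse to
    \<open>1 - t\<close>.\<close>
  have "norm y \<le> 1 * norm (y + x)"
    using assms(1) isosceles_orth_norm_le isosceles_orth_commute by fastforce
  from norm_combination_le[OF assms(3,4) this]
  have "norm (t *\<^sub>R x + (1 - t) *\<^sub>R y) \<le> (1 - t) * norm (x + y)"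
    by (simp add: add.commute)
  note a = power_mono[OF this norm_ge_zero, of 2]
  note b = power_mono[OF norm_combination_le[OF assms(3-5)] norm_ge_zero, of 2]
  have "(norm (t *\<^sub>R x + (1 - t) *\<^sub>R y))\<^sup>2 + (norm ((1 - t) *\<^sub>R x + t *\<^sub>R y))\<^sup>2
      \<le> ((1 - t)\<^sup>2 + (t + (1 - 2 * t) * c)\<^sup>2) * (norm (x + y))\<^sup>2"
    unfolding distrib_right[of "_\<^sup>2"] power_mult_distrib[symmetric] using a b by (rule add_mono)
  then show ?thesis using assms(2) by (simp add: pos_divide_le_eq)
qed

text \<open>The bound does not depend on the pair \<open>x\<close>, \<open>y\<close>, so it passes
  to the supremum; it is applied with \<open>c = 1 - \<delta>\<close>.\<close>

lemma L_set_le_of_non_square: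
  assumes ns: "\<forall>u\<in>sphere (0::'a::real_normed_vector) 1. \<forall>v\<in>sphere (0::'a) 1.
       norm (u + v) \<le> 2 * c \<or> norm (u - v) \<le> 2 * c"
    and t: "0 \<le> t" "t \<le> 1/2" and r: "r \<in> L_set TYPE('a) t"
  shows "r \<le> (1 - t)\<^sup>2 + (t + (1 - 2 * t) * c)\<^sup>2"
proof -
  obtain x y :: 'a where o: "x \<bottom>\<^sub>I y" "(x, y) \<noteq> (0, 0)" and
    r: "r = ((norm (t *\<^sub>R x + (1 - t) *\<^sub>R y))\<^sup>2 + (norm ((1 - t) *\<^sub>R x + t *\<^sub>R y))\<^sup>2)
          / (norm (x + y))\<^sup>2"
    using r unfolding L_set_def by blast
  define n where "n = norm (x + y)"
  have nz: "x + y \<noteq> 0" using isosceles_orth_add_nonzero[OF o] .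
  then have n: "n > 0" by (simp add: n_def)
  have n': "norm (x - y) = n" using o(1) by (simp add: isosceles_orth_def n_def)
  \<comment> \<open>Orthogonality lets the same \<open>n\<close> normalise both vectors, so their
    sum and difference are multiples of \<open>x\<close> and \<open>y\<close> alone.\<close>
  define u v where "u = (1/n) *\<^sub>R (x + y)" and "v = (1/n) *\<^sub>R (x - y)"
  have "u \<in> sphere 0 1" "v \<in> sphere 0 1"
    using n n' by (simp_all add: u_def v_def flip: n_def)
  moreover have "u + v = (2/n) *\<^sub>R x" "u - v = (2/n) *\<^sub>R y"
    by (simp_all add: u_def v_def algebra_simps flip: scaleR_left_distrib)
  ultimately have "norm x \<le> c * n \<or> norm y \<le> c * n"
    using ns n by (fastforce simp: field_simps)
  then show ?thesis
  proof
    assume "norm x \<le> c * n"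
    then show ?thesis using quotient_le_of_norm_le[OF o(1) nz t] by (simp add: r n_def)
  next
    assume "norm y \<le> c * n"
    \<comment> \<open>Swapping \<open>x\<close> and \<open>y\<close> only exchanges the two summands
      of the quotient.\<close>
    then show ?thesis
      using quotient_le_of_norm_le[of y x t c] o(1) nz t
      by (simp add: r n_def isosceles_orth_commute add.commute)
  qed
qed

theorem theorem10:
  fixes t0 :: real
  assumes "\<exists>B :: 'a::banach set. finite B \<and> span B = UNIV"
    and "dim (UNIV :: 'a set) \<ge> 2"
    and "t0 \<in> {0..<1/2}"
    and "L_const TYPE('a) t0 = 2 * t0\<^sup>2 - 4 * t0 + 2"
  shows "\<not> uniformly_non_square TYPE('a)"
proof
  assume "uniformly_non_square TYPE('a)"
  then obtain \<delta> :: real where \<delta>: "0 < \<delta>" "\<delta> < 1" and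
    ns: "\<forall>x\<in>sphere (0::'a) 1. \<forall>y\<in>sphere (0::'a) 1.
       norm (x + y) \<le> 2 * (1 - \<delta>) \<or> norm (x - y) \<le> 2 * (1 - \<delta>)"
    unfolding uniformly_non_square_def by auto
  have t: "0 \<le> t0" "t0 < 1/2" using assms(3) by auto
  \<comment> \<open>A nonzero vector makes \<open>L_set\<close> nonempty, as
    \<open>cSup_least\<close> requires.\<close>
  have "\<exists>x::'a. x \<noteq> 0"
  proof (rule ccontr)
    assume "\<nexists>x::'a. x \<noteq> 0"
    then have "(UNIV :: 'a set) = {0}" by auto
    then have "dim (UNIV :: 'a set) = 0" by (metis dim_span span_empty card.empty dim_eq_card_independent independent_empty)
    then show False using assms(2) by simp
  qed
  then have "L_set TYPE('a) t0 \<noteq> {}" by (rule L_set_nonempty)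
  then have "L_const TYPE('a) t0 \<le> (1 - t0)\<^sup>2 + (t0 + (1 - 2 * t0) * (1 - \<delta>))\<^sup>2"
    unfolding L_const_def using L_set_le_of_non_square[OF ns] t by (intro cSup_least) auto
  also have "(t0 + (1 - 2 * t0) * (1 - \<delta>))\<^sup>2 < (1 - t0)\<^sup>2"
  proof (rule power_strict_mono)
    show "0 \<le> t0 + (1 - 2 * t0) * (1 - \<delta>)" using t \<delta> by simp
    \<comment> \<open>This product is exactly the gap between the two bases; \<open>t0 < 1/2\<close>
      makes it positive.\<close>
    have "0 < (1 - 2 * t0) * \<delta>" using t \<delta> by simp
    then show "t0 + (1 - 2 * t0) * (1 - \<delta>) < 1 - t0" by (simp add: algebra_simps)
  qed simp
  \<comment> \<open>The chain ends in \<open>2 * (1 - t0)\<^sup>2\<close>, which expands to the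
    assumed value.\<close>
  finally show False using assms(4) by (simp add: power2_eq_square algebra_simps)
qed

end
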